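(* For $\lambda,\gamma\in\mathbb{R}$ let $\mathcal{Q}_0^{\widehat{\mathfrak{gl}}_1}(\lambda)$ be the integral operator $f\mapsto \int_{\mathbb{R}}\mathcal{Q}_0^{\widehat{\mathfrak{gl}}_1}(x,y|\lambda)f(y)\,dy$ with kernel $$\mathcal{Q}_0^{\widehat{\mathfrak{gl}}_1}(x,y|\lambda)=\exp\big\{ i\lambda(x-y)-e^{x-y}-e^{y-x}\big\},\qquad x,y\in\mathbb{R},$$ and let $\Psi_\gamma^{\widehat{\mathfrak{gl}}_1}(x)=e^{i\gamma x}$. Then $$\mathcal{Q}_0^{\widehat{\mathfrak{gl}}_1}(\lambda)\cdot\Psi_\gamma^{\widehat{\mathfrak{gl}}_1}(x)=Q_0^{\widehat{\mathfrak{gl}}_1}(\lambda,\gamma)\,\Psi_\gamma^{\widehat{\mathfrak{gl}}_1}(x),\qquad Q_0^{\widehat{\mathfrak{gl}}_1}(\lambda,\gamma)=2K_{i\lambda-i\gamma}(2)=\int_0^\infty \frac{dv}{v}\,v^{-i(\lambda-\gamma)}e^{-(v+v^{-1})}.$$ Moreover, the eigenvalue, extended by this integral formula to an entire function of $\lambda\in\mathbb{C}$, satisfies the Baxter equation $$(i\lambda-i\gamma)\,Q_0^{\widehat{\mathfrak{gl}}_1}(\lambda,\gamma)+Q_0^{\widehat{\mathfrak{gl}}_1}(\lambda+i,\gamma)-Q_0^{\widehat{\mathfrak{gl}}_1}(\lambda-i,\gamma)=0.$$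
   Context: Here $i=\sqrt{-1}$ and $K_\nu$ is the Macdonald function (modified Bessel function of the second kind), given for $\nu\in\mathbb{C}$, $\tau\in\mathbb{R}$ by $$K_\nu(2e^{\tau})=\frac12\int_0^\infty v^{-\nu-1}e^{-e^{\tau}(v+v^{-1})}\,dv.$$ *)

theory Defs
  imports "HOL-Analysis.Analysis"
begin

(* K_nu(z) for z > 0.  The usual normalisation has z = 2 e^tau, so e^tau = z/2;
   see macdonald_K_two_exp for that form. *)
definition macdonald_K :: "complex \<Rightarrow> real \<Rightarrow> complex" where
  "macdonald_K \<nu> z =
     1 / 2 * (LBINT v:{0<..}. complex_of_real v powr (- \<nu> - 1)
                  * complex_of_real (exp (- (z / 2) * (v + inverse v))))"

lemma macdonald_K_two_exp:
  "macdonald_K \<nu> (2 * exp \<tau>) =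
     1 / 2 * (LBINT v:{0<..}. complex_of_real v powr (- \<nu> - 1)
                  * complex_of_real (exp (- exp \<tau> * (v + inverse v))))"
  by (simp add: macdonald_K_def)

definition Q0_kernel :: "real \<Rightarrow> real \<Rightarrow> real \<Rightarrow> complex" where
  "Q0_kernel lam x y =
     exp (\<i> * complex_of_real lam * complex_of_real (x - y)
          - complex_of_real (exp (x - y)) - complex_of_real (exp (y - x)))"

definition Q0_operator :: "real \<Rightarrow> (real \<Rightarrow> complex) \<Rightarrow> real \<Rightarrow> complex" where
  "Q0_operator lam f x = (LBINT y. Q0_kernel lam x y * f y)"

definition Psi :: "real \<Rightarrow> real \<Rightarrow> complex" where
  "Psi \<gamma> x = exp (\<i> * complex_of_real \<gamma> * complex_of_real x)"

(* The spectral parameter is complex: this is the extension by the integral formula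
   of the eigenvalue, which is first obtained for real parameter. *)
definition Q0_eigenvalue :: "complex \<Rightarrow> real \<Rightarrow> complex" where
  "Q0_eigenvalue \<mu> \<gamma> =
     (LBINT v:{0<..}. complex_of_real (1 / v)
          * complex_of_real v powr (- \<i> * (\<mu> - complex_of_real \<gamma>))
          * complex_of_real (exp (- (v + inverse v))))"

end

theory Submission
  imports Defs "HOL-Probability.Distributions" "HOL-Complex_Analysis.Cauchy_Integral_Formula"
    "HOL-Real_Asymp.Real_Asymp"
begin

text \<open>
  In the logarithmic variable \<open>t = ln v\<close> the eigenvalue is \<open>F(s)\<close> at \<open>s = - \<i> (\<mu> - \<gamma>)\<close>, where
  \<open>F\<close> is the two-sided Laplace transform of the weight \<open>exp (- exp t - exp (- t))\<close>. The kernel depends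
  on \<open>x - y\<close> only, so plane waves are eigenfunctions. Since the weight decays faster than any
  exponential, \<open>F\<close> is given by an everywhere convergent power series. The Baxter equation says that
  the integral of the derivative of \<open>exp (s t - exp t - exp (- t))\<close> vanishes.
\<close>

definition toda_weight :: "complex \<Rightarrow> real \<Rightarrow> complex" where
  "toda_weight s t = exp (s * of_real t - of_real (exp t) - of_real (exp (- t)))"

definition toda_laplace :: "complex \<Rightarrow> complex" where
  "toda_laplace s = (LBINT t. toda_weight s t)"

lemma norm_toda_weight: "norm (toda_weight s t) = exp (Re s * t - exp t - exp (- t))"
  by (simp add: toda_weight_def)

lemma toda_weight_split: "toda_weight s t = exp (s * of_real t) * of_real (exp (- exp t - exp (- t)))"
  by (simp add: toda_weight_def exp_of_real[symmetric] exp_add[symmetric] algebra_simps)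

lemma continuous_on_toda_weight: "continuous_on A (toda_weight s)"
  unfolding toda_weight_def by (intro continuous_intros)

lemma borel_measurable_toda_weight [measurable]: "toda_weight s \<in> borel_measurable borel"
  by (intro borel_measurable_continuous_onI continuous_on_toda_weight)

text \<open>The exponential with nonnegative argument dominates its quadratic Taylor term, and the
  other one is nonnegative. This crude bound suffices to compare the weight with a Gaussian.\<close>

lemma exp_plus_exp_minus_ge: "exp t + exp (- t) \<ge> t\<^sup>2 / 2" for t :: real
proof (cases "t \<ge> 0")
  case True
  then show ?thesis
    using exp_lower_Taylor_quadratic[of t] exp_ge_zero[of "-t"] by linarith
next
  case False
  then show ?thesis
    using exp_lower_Taylor_quadratic[of "-t"] exp_ge_zero[of t] unfolding power2_minus by linarith
qed

lemma integrable_toda_weight [simp]: "integrable lborel (toda_weight s)"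
proof (rule Bochner_Integration.integrable_bound)
  \<comment> \<open>Completing the square in \<open>?a * t - t^2 / 2\<close> gives a Gaussian with
    mean \<open>?a\<close> and variance 1; the constant undoes its normalisation and restores
    \<open>exp (?a^2 / 2)\<close>.\<close>
  let ?a = "Re s"
  show "integrable lborel (\<lambda>t. (exp (?a\<^sup>2 / 2) * sqrt (2 * pi)) * normal_density ?a 1 t)"
    by simp
  show "toda_weight s \<in> borel_measurable lborel"
    by simp
  have "norm (toda_weight s t) \<le> norm (exp (?a\<^sup>2 / 2) * sqrt (2 * pi) * normal_density ?a 1 t)" for t
  proof -
    have "norm (toda_weight s t) \<le> exp (?a\<^sup>2 / 2 + - (t - ?a)\<^sup>2 / 2)"
      unfolding norm_toda_weight exp_le_cancel_iff using exp_plus_exp_minus_ge[of t]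
      by (simp add: power2_eq_square algebra_simps diff_divide_distrib add_divide_distrib)
    also have "\<dots> = exp (?a\<^sup>2 / 2) * sqrt (2 * pi) * normal_density ?a 1 t"
      unfolding exp_add by (simp add: normal_density_def)
    finally show ?thesis
      by simp
  qed
  then show "AE t in lborel. norm (toda_weight s t)
      \<le> norm (exp (?a\<^sup>2 / 2) * sqrt (2 * pi) * normal_density ?a 1 t)"
    by simp
qed

text \<open>Expanding \<open>exp (s * t)\<close> and integrating term by term yields a power series
  in \<open>s\<close> whose coefficients \<open>c n\<close> are the moments of the weight divided by
  \<open>fact n\<close>.\<close>

lemma toda_laplace_holomorphic: "toda_laplace holomorphic_on A"
proof -
  let ?w = "\<lambda>t::real. exp (- exp t - exp (- t))"
  let ?term = "\<lambda>s n t. (s * of_real t) ^ n /\<^sub>R fact n * of_real (?w t) :: complex"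
  define c :: "nat \<Rightarrow> complex" where "c n = (LBINT t. ?term 1 n t)" for n
  \<comment> \<open>Since \<open>exp (r * \<bar>t\<bar>)\<close> is one of
    \<open>exp (r * t)\<close> and \<open>exp (- r * t)\<close>, the sum of the two weights is an
    integrable majorant of all partial sums at once.\<close>
  define B where "B r t = norm (toda_weight (of_real r) t) + norm (toda_weight (of_real (- r)) t)"
    for r t :: real
  have B_int: "integrable lborel (B r)" for r
    unfolding B_def by (intro Bochner_Integration.integrable_add integrable_norm integrable_toda_weight)
  have B_ge: "exp (norm s * \<bar>t\<bar>) * ?w t \<le> B (norm s) t" for s :: complex and t
    by (cases "t \<ge> 0") (simp_all add: B_def norm_toda_weight exp_add[symmetric] add_diff_eq)
  have term_norm: "norm (?term s n t) = (norm s * \<bar>t\<bar>) ^ n /\<^sub>R fact n * ?w t" for s n t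
    by (simp add: norm_mult norm_power power_mult_distrib)
  have partial: "(\<Sum>k<n. norm (?term s k t)) \<le> B (norm s) t" for s n t
  proof -
    have "(\<Sum>k<n. norm (?term s k t)) = (\<Sum>k<n. (norm s * \<bar>t\<bar>) ^ k /\<^sub>R fact k) * ?w t"
      by (simp only: term_norm sum_distrib_right)
    also have "\<dots> \<le> exp (norm s * \<bar>t\<bar>) * ?w t"
    proof (intro mult_right_mono)
      show "(\<Sum>k<n. (norm s * \<bar>t\<bar>) ^ k /\<^sub>R fact k) \<le> exp (norm s * \<bar>t\<bar>)"
        unfolding exp_def by (intro sum_le_suminf summable_exp_generic) auto
    qed simp
    finally show ?thesis
      using B_ge[of s t] by linarith
  qed
  \<comment> \<open>A single term is bounded by the partial sum of norms up to and including index
    \<open>n\<close>, hence by the same majorant.\<close>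
  have term_int: "integrable lborel (?term s n)" for s n
  proof (rule Bochner_Integration.integrable_bound[OF B_int[of "norm s"]])
    have "norm (?term s n t) \<le> norm (B (norm s) t)" for t
    proof -
      have "norm (?term s n t) \<le> (\<Sum>k<Suc n. norm (?term s k t))"
        by (rule member_le_sum) auto
      then show ?thesis
        using partial[of s t "Suc n"] by simp
    qed
    then show "AE t in lborel. norm (?term s n t) \<le> norm (B (norm s) t)"
      by simp
  qed simp
  have "(\<lambda>n. c n * s ^ n) sums toda_laplace s" for s
  proof -
    have "(\<lambda>n. LBINT t. (\<Sum>k<n. ?term s k t)) \<longlonglongrightarrow> toda_laplace s"
      unfolding toda_laplace_def
    proof (rule integral_dominated_convergence[OF _ _ B_int[of "norm s"]])
      have "(\<lambda>k. ?term s k t) sums toda_weight s t" for t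
        unfolding toda_weight_split by (intro sums_mult2 exp_converges)
      then show "AE t in lborel. (\<lambda>n. \<Sum>k<n. ?term s k t) \<longlonglongrightarrow> toda_weight s t"
        by (simp add: sums_def)
      show "AE t in lborel. norm (\<Sum>k<n. ?term s k t) \<le> B (norm s) t" for n
        using order_trans[OF norm_sum partial] by blast
    qed simp_all
    moreover have "(LBINT t. (\<Sum>k<n. ?term s k t)) = (\<Sum>k<n. c k * s ^ k)" for n
    proof -
      have "(LBINT t. ?term s k t) = c k * s ^ k" for k
        unfolding c_def integral_mult_left_zero[symmetric]
        by (rule Bochner_Integration.integral_cong) (simp_all add: power_mult_distrib)
      then show ?thesis
        by (subst Bochner_Integration.integral_sum) (use term_int in auto)
    qed
    ultimately show ?thesis
      by (simp add: sums_def)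
  qed
  \<comment> \<open>The series converges at every \<open>s\<close>, so the radius is arbitrary;
    below, \<open>norm s + 1\<close> puts \<open>s\<close> inside an open ball.\<close>
  then have "toda_laplace holomorphic_on ball 0 r" for r
    using power_series_holomorphic[of 0 r c toda_laplace] by simp
  then have "toda_laplace field_differentiable at s" for s
    using holomorphic_on_imp_differentiable_at[of toda_laplace "ball 0 (norm s + 1)" s] by simp
  then show ?thesis
    by (simp add: holomorphic_on_def field_differentiable_at_within)
qed

lemma toda_laplace_recurrence:
  "s * toda_laplace s - toda_laplace (s + 1) + toda_laplace (s - 1) = 0"
proof -
  let ?D = "\<lambda>t. s * toda_weight s t - toda_weight (s + 1) t + toda_weight (s - 1) t"
  \<comment> \<open>These turn the factors \<open>exp t\<close> and \<open>exp (- t)\<close>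
    produced by differentiation into unit shifts of \<open>s\<close>.\<close>
  have shift: "toda_weight (s + 1) t = of_real (exp t) * toda_weight s t"
    "toda_weight (s - 1) t = of_real (exp (- t)) * toda_weight s t" for t
    by (simp_all add: toda_weight_split algebra_simps exp_add exp_diff exp_minus exp_of_real field_simps)
  \<comment> \<open>At either end one of the double exponentials beats the linear exponent, so the
    boundary terms vanish.\<close>
  have lim: "(toda_weight s \<longlongrightarrow> 0) F" if "F = at_top \<or> F = at_bot" for F
  proof (rule tendsto_norm_zero_cancel)
    define a where "a = Re s"
    have "((\<lambda>t. exp (a * t - exp t - exp (- t))) \<longlongrightarrow> 0) F"
      using that by (elim disjE; hypsubst; real_asymp)
    then show "((\<lambda>t. norm (toda_weight s t)) \<longlongrightarrow> 0) F"
      by (simp add: norm_toda_weight a_def)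
  qed
  have deriv: "(toda_weight s has_vector_derivative ?D t) (at t)" for t
  proof -
    \<comment> \<open>The weight is the restriction of an entire function, which is differentiated
      in the complex variable and then restricted to the real line.\<close>
    have "((\<lambda>z. exp (s * z - exp z - exp (- z))) has_field_derivative
        (s - exp (of_real t) + exp (- of_real t))
          * exp (s * of_real t - exp (of_real t) - exp (- of_real t))) (at (of_real t))"
      by (auto intro!: derivative_eq_intros)
    from has_vector_derivative_real_field[OF this]
    have "((\<lambda>t. exp (s * of_real t - exp (of_real t) - exp (- of_real t))) has_vector_derivative
        (s - exp (of_real t) + exp (- of_real t))
          * exp (s * of_real t - exp (of_real t) - exp (- of_real t))) (at t)"
      by simp
    moreover have "toda_weight s = (\<lambda>t. exp (s * of_real t - exp (of_real t) - exp (- of_real t)))"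
      by (simp add: fun_eq_iff toda_weight_def exp_of_real[symmetric])
    moreover have "?D t = (s - exp (of_real t) + exp (- of_real t)) * toda_weight s t"
      unfolding shift by (simp add: exp_of_real[symmetric] algebra_simps)
    ultimately show ?thesis
      by simp
  qed
  have int: "integrable lborel ?D"
    by simp
  have "(LBINT t=-\<infinity>..\<infinity>. ?D t) = 0 - 0"
  proof (rule interval_integral_FTC_integrable)
    show "isCont ?D t" for t
      using continuous_on_toda_weight[of UNIV]
      by (intro continuous_intros) (auto simp: continuous_on_eq_continuous_at)
    show "set_integrable lborel (einterval (-\<infinity>) \<infinity>) ?D"
      using int by (simp add: set_integrable_def)
    show "((toda_weight s \<circ> real_of_ereal) \<longlongrightarrow> 0) (at_right (-\<infinity>))"
      using lim[of at_bot] by (simp add: ereal_tendsto_simps1)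
    show "((toda_weight s \<circ> real_of_ereal) \<longlongrightarrow> 0) (at_left \<infinity>)"
      using lim[of at_top] by (simp add: ereal_tendsto_simps1)
  qed (use deriv in auto)
  then show ?thesis
    by (simp add: interval_lebesgue_integral_def set_lebesgue_integral_def toda_laplace_def)
qed

text \<open>Substituting \<open>v = exp t\<close> makes the Jacobian cancel \<open>1 / v\<close>,
  and \<open>v powr s\<close> becomes \<open>exp (s * t)\<close>.\<close>

lemma mellin_eq_toda_laplace:
  fixes s :: complex
  defines "f \<equiv> \<lambda>v::real. of_real (1 / v) * of_real v powr s * of_real (exp (- (v + inverse v))) :: complex"
  shows "set_integrable lborel {0<..} f"
    and "(LBINT v:{0<..}. f v) = toda_laplace s"
proof -
  have fexp: "\<bar>exp t\<bar> *\<^sub>R f (exp t) = toda_weight s t" for t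
    by (simp add: f_def toda_weight_split powr_def scaleR_conv_of_real exp_minus Ln_of_real)
  \<comment> \<open>The change of variables is an equivalence about the completed Lebesgue measure.
    Borel measurability of both integrands allows the passage from \<open>lborel\<close> and
    back.\<close>
  have "toda_weight s absolutely_integrable_on UNIV"
    by (simp add: set_integrable_def integrable_completion)
  moreover have "integral UNIV (toda_weight s) = toda_laplace s"
    unfolding toda_laplace_def by (simp add: integral_lborel)
  moreover have "exp ` UNIV = {0::real<..}"
    by (auto simp: image_iff) (metis exp_total)
  ultimately have *: "f absolutely_integrable_on {0<..} \<and> integral {0<..} f = toda_laplace s"
    using has_absolute_integral_change_of_variables_real[of UNIV exp exp f "toda_laplace s"]
    by (simp add: fexp[simplified] DERIV_exp inj_def)
  have [measurable]: "(\<lambda>v. indicator {0<..} v *\<^sub>R f v) \<in> borel_measurable borel"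
    unfolding f_def powr_def by measurable
  from * show 1: "set_integrable lborel {0<..} f"
    by (simp add: set_integrable_def integrable_completion)
  then show "(LBINT v:{0<..}. f v) = toda_laplace s"
    using * set_borel_integral_eq_integral(2)[OF 1] by simp
qed

lemma Q0_eigenvalue_eq: "Q0_eigenvalue \<mu> \<gamma> = toda_laplace (- \<i> * (\<mu> - of_real \<gamma>))"
  unfolding Q0_eigenvalue_def by (rule mellin_eq_toda_laplace)

lemma Q0_eigenvalue_eq_macdonald_K:
  "Q0_eigenvalue \<mu> \<gamma> = 2 * macdonald_K (\<i> * \<mu> - \<i> * of_real \<gamma>) 2"
proof -
  \<comment> \<open>The factor \<open>1 / v\<close> is the \<open>- 1\<close> in the Macdonald
    exponent; at \<open>z = 2\<close> the factor \<open>z / 2\<close> in the exponential is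
    1.\<close>
  have powr_shift: "of_real (1 / v) * of_real v powr (- \<i> * (\<mu> - of_real \<gamma>))
      = of_real v powr (- (\<i> * \<mu> - \<i> * of_real \<gamma>) - 1)" if "v > 0" for v :: real
  proof -
    have "- (\<i> * \<mu> - \<i> * of_real \<gamma>) - 1 = - \<i> * (\<mu> - of_real \<gamma>) - 1"
      by (simp add: algebra_simps)
    then show ?thesis
      using that by (simp only: powr_diff) simp
  qed
  have "Q0_eigenvalue \<mu> \<gamma> = (LBINT v:{0<..}. of_real v powr (- (\<i> * \<mu> - \<i> * of_real \<gamma>) - 1)
      * of_real (exp (- (v + inverse v))))"
    unfolding Q0_eigenvalue_def
    by (intro set_lebesgue_integral_cong allI impI) (simp, simp only: greaterThan_iff powr_shift)
  then show ?thesis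
    by (simp add: macdonald_K_def)
qed

(* The argument has the shape t + c * y of lborel_integral_real_affine. *)
lemma Q0_kernel_times_Psi:
  "Q0_kernel lam x y * Psi \<gamma> y
    = toda_weight (- \<i> * (of_real lam - of_real \<gamma>)) (- x + 1 * y) * Psi \<gamma> x"
  by (simp add: Q0_kernel_def Psi_def toda_weight_def exp_add[symmetric] algebra_simps)

text \<open>Translation invariance of Lebesgue measure removes \<open>x\<close> from the shifted
  weight, and the constant factor \<open>Psi \<gamma> x\<close> leaves the integral.\<close>

lemma Q0_operator_Psi:
  shows "integrable lborel (\<lambda>y. Q0_kernel lam x y * Psi \<gamma> y)"
    and "Q0_operator lam (Psi \<gamma>) x = Q0_eigenvalue (of_real lam) \<gamma> * Psi \<gamma> x"
proof -
  let ?g = "toda_weight (- \<i> * (of_real lam - of_real \<gamma>))"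
  have "integrable lborel (\<lambda>y. ?g (- x + 1 * y))"
    by (rule lborel_integrable_real_affine) simp_all
  then show "integrable lborel (\<lambda>y. Q0_kernel lam x y * Psi \<gamma> y)"
    unfolding Q0_kernel_times_Psi by (rule integrable_mult_left)
  have "(LBINT y. ?g (- x + 1 * y)) = (LBINT t. ?g t)"
    using lborel_integral_real_affine[of 1 ?g "- x"] by simp
  then show "Q0_operator lam (Psi \<gamma>) x = Q0_eigenvalue (of_real lam) \<gamma> * Psi \<gamma> x"
    unfolding Q0_operator_def Q0_kernel_times_Psi Q0_eigenvalue_eq toda_laplace_def
    by (simp only: integral_mult_left_zero)
qed

lemma Q0_eigenvalue_holomorphic: "(\<lambda>\<mu>. Q0_eigenvalue \<mu> \<gamma>) holomorphic_on A"
  unfolding Q0_eigenvalue_eq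
  by (rule holomorphic_on_compose[OF _ toda_laplace_holomorphic, unfolded o_def])
     (intro holomorphic_intros)

lemma Q0_eigenvalue_Baxter:
  "(\<i> * \<mu> - \<i> * of_real \<gamma>) * Q0_eigenvalue \<mu> \<gamma>
     + Q0_eigenvalue (\<mu> + \<i>) \<gamma> - Q0_eigenvalue (\<mu> - \<i>) \<gamma> = 0"
proof -
  define s where "s = - \<i> * (\<mu> - of_real \<gamma>)"
  \<comment> \<open>As \<open>- \<i> * \<i> = 1\<close>, imaginary shifts of \<open>\<mu>\<close>
    are unit shifts of \<open>s\<close>, and the Baxter equation is the negative of the
    recurrence.\<close>
  have "- \<i> * (\<mu> + \<i> - of_real \<gamma>) = s + 1" "- \<i> * (\<mu> - \<i> - of_real \<gamma>) = s - 1"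
    "\<i> * \<mu> - \<i> * of_real \<gamma> = - s"
    by (simp_all add: s_def algebra_simps)
  then show ?thesis
    using toda_laplace_recurrence[of s] unfolding Q0_eigenvalue_eq s_def[symmetric]
    by (simp add: algebra_simps)
qed

theorem mainTheorem3:
  fixes lam \<gamma> :: real
  shows "(\<forall>x. integrable lborel (\<lambda>y. Q0_kernel lam x y * Psi \<gamma> y) \<and>
              Q0_operator lam (Psi \<gamma>) x = Q0_eigenvalue (complex_of_real lam) \<gamma> * Psi \<gamma> x)
    \<and> Q0_eigenvalue (complex_of_real lam) \<gamma>
        = 2 * macdonald_K (\<i> * complex_of_real lam - \<i> * complex_of_real \<gamma>) 2
    \<and> 2 * macdonald_K (\<i> * complex_of_real lam - \<i> * complex_of_real \<gamma>) 2
        = (LBINT v:{0<..}. complex_of_real (1 / v)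
             * complex_of_real v powr (- \<i> * (complex_of_real lam - complex_of_real \<gamma>))
             * complex_of_real (exp (- (v + inverse v))))
    \<and> (\<forall>\<mu>::complex. set_integrable lborel {0<..}
           (\<lambda>v. complex_of_real (1 / v)
             * complex_of_real v powr (- \<i> * (\<mu> - complex_of_real \<gamma>))
             * complex_of_real (exp (- (v + inverse v)))))
    \<and> (\<lambda>\<mu>. Q0_eigenvalue \<mu> \<gamma>) holomorphic_on UNIV
    \<and> (\<forall>\<mu>::complex.
          (\<i> * \<mu> - \<i> * complex_of_real \<gamma>) * Q0_eigenvalue \<mu> \<gamma>
            + Q0_eigenvalue (\<mu> + \<i>) \<gamma> - Q0_eigenvalue (\<mu> - \<i>) \<gamma> = 0)"
  by (intro conjI allI Q0_operator_Psi Q0_eigenvalue_eq_macdonald_K Q0_eigenvalue_holomorphic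
        Q0_eigenvalue_Baxter mellin_eq_toda_laplace(1)
        Q0_eigenvalue_eq_macdonald_K[symmetric, unfolded Q0_eigenvalue_def])

end
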